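(* Let $m,n$ be integers with $m\ge 4$ and $n\ge m+5$ (so that $S=\{2,m,m+2,n-1\}$ is $n$-admissible), and define $p(S;n)$ by $\#P(S;n)=p(S;n)\,2^{n-5}$. Then $$2p(S;n)=(m-3)(n-m-4)\Big[m\binom{n-1}{m+1}+(n-m-1)\binom{n-1}{m-1}\Big]+(n-1)\Big[m(m-3)\binom{n-2}{m+1}+(n-m-1)(n-m-4)\binom{n-2}{m-2}-2(n-6)\binom{n-4}{m-1}-2(n-6)\binom{n-4}{m-2}+4\binom{n-4}{1}\Big].$$
   Context: For a permutation $\pi=a_1\ldots a_n$ of $\{1,\ldots,n\}$, an index $i$ is a peak if $a_{i-1}<a_i>a_{i+1}$. $P(S;n)$ is the set of permutations of $\{1,\dots,n\}$ whose set of peaks is exactly $S$. *)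

theory Defs
  imports Complex_Main "HOL-Combinatorics.Permutations"
begin

text \<open>A permutation \<open>a\<^sub>1 \<dots> a\<^sub>n\<close> of \<open>{1..n}\<close> is a function \<open>\<pi>\<close> that permutes \<open>{1..n}\<close>, with \<open>a\<^sub>i = \<pi> i\<close>.
  A peak needs both neighbours, so the endpoints \<open>1\<close> and \<open>n\<close> are never peaks.\<close>

definition peaks :: "nat \<Rightarrow> (nat \<Rightarrow> nat) \<Rightarrow> nat set" where
  "peaks n \<pi> = {i. 1 < i \<and> i < n \<and> \<pi> (i - 1) < \<pi> i \<and> \<pi> i > \<pi> (i + 1)}"

definition peak_perms :: "nat set \<Rightarrow> nat \<Rightarrow> (nat \<Rightarrow> nat) set" where
  "peak_perms S n = {\<pi>. \<pi> permutes {1..n} \<and> peaks n \<pi> = S}"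

end

theory Submission
  imports Defs "HOL-Library.Infinite_Set"
begin

text \<open>The largest letter of a permutation sits at a peak or at one of the two ends, and the words to
  its left and right are arbitrary words on complementary sets of letters. This gives a recurrence
  for the number of permutations with a given peak set. Since 2 and \<open>n - 1\<close> are peaks, the largest
  letter of a permutation counted in the theorem is at 2, \<open>m\<close>, \<open>m + 2\<close> or \<open>n - 1\<close>, which leaves the
  peak sets \<open>{2}\<close>, \<open>{j}\<close>, \<open>{2, j}\<close> and \<open>{2, j, j + 2}\<close> up to reversal; their counts, together with
  that of \<open>{j, j + 2}\<close>, follow by induction on the length from the same recurrence.\<close>

section \<open>Words on a finite set of letters, counted by peak set\<close>

text \<open>Peaks are numbered from 1 as in \<open>peaks\<close>, list entries from 0.\<close>

definition list_peaks :: "nat list \<Rightarrow> nat set" where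
  "list_peaks xs = {i. 1 < i \<and> i < length xs \<and> xs ! (i - 2) < xs ! (i - 1) \<and> xs ! i < xs ! (i - 1)}"

text \<open>The alphabet \<open>A\<close> is arbitrary because the parts to the left and right of
  the largest letter use arbitrary complementary sets of letters.\<close>

definition words :: "nat set \<Rightarrow> nat set \<Rightarrow> nat list set" where
  "words A S = {xs. distinct xs \<and> set xs = A \<and> list_peaks xs = S}"

text \<open>\<open>{..<k}\<close> is the standard alphabet with \<open>k\<close> letters; passing to
  \<open>Suc k\<close> adds \<open>k\<close> as the new largest letter.\<close>

definition num_words :: "nat set \<Rightarrow> nat \<Rightarrow> nat" where
  "num_words S k = card (words {..<k} S)"

lemma list_peaks_subset: "list_peaks xs \<subseteq> {2..<length xs}"
  by (auto simp: list_peaks_def)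

lemma length_word: "xs \<in> words A S \<Longrightarrow> length xs = card A"
  by (auto simp: words_def distinct_card)

lemma finite_words: "finite A \<Longrightarrow> finite (words A S)"
  by (rule finite_subset[of _ "{xs. set xs \<subseteq> A \<and> length xs = card A}"])
     (auto simp: words_def distinct_card finite_lists_length_eq)

lemma list_peaks_map:
  assumes "strict_mono_on (set xs) f"
  shows "list_peaks (map f xs) = list_peaks xs"
proof -
  have *: "f x < f y \<longleftrightarrow> x < y" if "x \<in> set xs" "y \<in> set xs" for x y
    using assms that by (meson strict_mono_on_less)
  show ?thesis
    unfolding list_peaks_def by (rule Collect_cong) (auto simp: *)
qed

text \<open>Peaks depend only on the relative order of the letters, so relabelling along the
  increasing bijection from \<open>{..<card A}\<close> to \<open>A\<close> preserves them.\<close>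

lemma card_words:
  assumes "finite A"
  shows "card (words A S) = num_words S (card A)"
proof -
  obtain f where f: "bij_betw f {..<card A} A" "strict_mono_on {..<card A} f"
    using ex_bij_betw_strict_mono_card[OF assms] by blast
  have "bij_betw (map f) (words {..<card A} S) (words A S)"
  proof (rule bij_betw_imageI)
    show "inj_on (map f) (words {..<card A} S)"
      using f(1) by (auto simp: words_def bij_betw_def inj_on_def intro: map_inj_on)
    show "map f ` words {..<card A} S = words A S"
    proof (intro equalityI subsetI)
      fix ys assume "ys \<in> map f ` words {..<card A} S"
      then show "ys \<in> words A S"
        using f by (auto simp: words_def list_peaks_map distinct_map bij_betw_def)
    next
      fix ys assume ys: "ys \<in> words A S"
      let ?g = "the_inv_into {..<card A} f"
      have g: "bij_betw ?g A {..<card A}"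
        using f(1) bij_betw_the_inv_into by blast
      have *: "distinct ys" "set ys = A" "list_peaks ys = S"
        using ys by (auto simp: words_def)
      have eq: "map f (map ?g ys) = ys"
        using * f(1) by (auto simp: bij_betw_def f_the_inv_into_f intro!: map_idI)
      have set: "set (map ?g ys) = {..<card A}" and dist: "distinct (map ?g ys)"
        using * g by (simp_all add: bij_betw_def distinct_map)
      have "list_peaks (map ?g ys) = S"
        using list_peaks_map[of "map ?g ys" f] f(2) *(3) unfolding eq set by simp
      with set dist have "map ?g ys \<in> words {..<card A} S"
        by (simp only: words_def mem_Collect_eq simp_thms)
      then show "ys \<in> map f ` words {..<card A} S"
        by (rule rev_image_eqI) (rule eq[symmetric])
    qed
  qed
  then show ?thesis
    by (simp add: num_words_def bij_betw_same_card)
qed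

text \<open>The bijection is one-line notation; \<open>card_words\<close> then replaces the alphabet
  \<open>{1..n}\<close> by \<open>{..<n}\<close>.\<close>

lemma card_peak_perms: "card (peak_perms S n) = num_words S n"
proof -
  have "bij_betw (\<lambda>\<pi>. map \<pi> [1..<Suc n]) (peak_perms S n) (words {1..n} S)"
  proof (rule bij_betw_imageI)
    show "inj_on (\<lambda>\<pi>. map \<pi> [1..<Suc n]) (peak_perms S n)"
    proof (rule inj_onI)
      fix \<pi> \<sigma> assume *: "\<pi> \<in> peak_perms S n" "\<sigma> \<in> peak_perms S n"
        "map \<pi> [1..<Suc n] = map \<sigma> [1..<Suc n]"
      show "\<pi> = \<sigma>"
      proof
        fix x show "\<pi> x = \<sigma> x"
        proof (cases "x \<in> {1..n}")
          case True then show ?thesis using *(3) by auto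
        next
          case False then show ?thesis
            using *(1,2) by (auto simp: peak_perms_def permutes_def)
        qed
      qed
    qed
    have peaks: "list_peaks (map \<pi> [1..<Suc n]) = peaks n \<pi>" for \<pi>
      proof -
      have "map \<pi> [1..<Suc n] ! (i - 2) = \<pi> (i - 1)" "map \<pi> [1..<Suc n] ! (i - 1) = \<pi> i"
        "map \<pi> [1..<Suc n] ! i = \<pi> (i + 1)" if "1 < i" "i < n" for i
        using that by (auto simp del: upt_Suc intro!: arg_cong[where f = \<pi>])
      then show ?thesis
        unfolding list_peaks_def peaks_def by (auto simp del: upt_Suc)
    qed
    show "(\<lambda>\<pi>. map \<pi> [1..<Suc n]) ` peak_perms S n = words {1..n} S"
    proof (intro equalityI subsetI)
      fix xs assume "xs \<in> (\<lambda>\<pi>. map \<pi> [1..<Suc n]) ` peak_perms S n"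
      then obtain \<pi> where \<pi>: "\<pi> permutes {1..n}" "peaks n \<pi> = S" "xs = map \<pi> [1..<Suc n]"
        by (auto simp: peak_perms_def)
      have set: "set [1..<Suc n] = {1..n}" by auto
      have "distinct xs" "set xs = {1..n}"
        unfolding \<pi>(3) distinct_map set_map set
        using \<pi>(1) by (auto simp: permutes_inj_on permutes_image simp del: upt_Suc)
      then show "xs \<in> words {1..n} S"
        using \<pi> peaks by (simp add: words_def)
    next
      fix xs assume xs: "xs \<in> words {1..n} S"
      then have len: "length xs = n" using length_word by fastforce
      \<comment> \<open>\<open>permutes\<close> demands the identity outside \<open>{1..n}\<close>;
        the shift by one converts positions from 1 to list indices from 0.\<close>
      define \<pi> where "\<pi> x = (if x \<in> {1..n} then xs ! (x - 1) else x)" for x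
      have eq: "map \<pi> [1..<Suc n] = xs"
        by (rule nth_equalityI) (auto simp: len \<pi>_def simp del: upt_Suc)
      have "bij_betw \<pi> {1..n} {1..n}"
      proof (rule bij_betw_imageI)
        have set: "set [1..<Suc n] = {1..n}" by auto
        have "distinct (map \<pi> [1..<Suc n])" "set (map \<pi> [1..<Suc n]) = {1..n}"
          unfolding eq using xs by (auto simp: words_def)
        then show "inj_on \<pi> {1..n}" "\<pi> ` {1..n} = {1..n}"
          unfolding distinct_map set_map set by simp_all
      qed
      then have "\<pi> permutes {1..n}"
        by (rule bij_imp_permutes) (auto simp: \<pi>_def)
      then have "\<pi> \<in> peak_perms S n"
        using peaks[of \<pi>] eq xs by (simp add: peak_perms_def words_def)
      then show "xs \<in> (\<lambda>\<pi>. map \<pi> [1..<Suc n]) ` peak_perms S n"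
        using eq by (metis imageI)
    qed
  qed
  then show ?thesis
    using card_words[of "{1..n}" S] by (simp add: bij_betw_same_card)
qed

section \<open>Reversal symmetry and peak sets that cannot occur\<close>

lemma list_peaks_rev: "list_peaks (rev xs) = (\<lambda>i. length xs + 1 - i) ` list_peaks xs"
proof -
  have sub: "(\<lambda>i. length xs + 1 - i) ` list_peaks xs \<subseteq> list_peaks (rev xs)" for xs
  proof
    fix j assume "j \<in> (\<lambda>i. length xs + 1 - i) ` list_peaks xs"
    then obtain i where i: "1 < i" "i < length xs" "xs ! (i - 2) < xs ! (i - 1)"
        "xs ! i < xs ! (i - 1)" "j = length xs + 1 - i"
      by (auto simp: list_peaks_def)
    have "rev xs ! (j - 2) = xs ! i" "rev xs ! (j - 1) = xs ! (i - 1)" "rev xs ! j = xs ! (i - 2)"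
      using i by (auto simp: rev_nth intro!: arg_cong[where f = "(!) xs"])
    then show "j \<in> list_peaks (rev xs)"
      using i by (simp add: list_peaks_def) linarith
  qed
  \<comment> \<open>The other inclusion is the first one applied to \<open>rev xs\<close>, as the
    reflection is an involution on possible peak positions.\<close>
  have "i \<in> (\<lambda>i. length xs + 1 - i) ` list_peaks xs" if "i \<in> list_peaks (rev xs)" for i
  proof (rule image_eqI)
    show "length xs + 1 - i \<in> list_peaks xs" using sub[of "rev xs"] that by force
    show "i = length xs + 1 - (length xs + 1 - i)"
      using that list_peaks_subset[of "rev xs"] by force
  qed
  then show ?thesis using sub by blast
qed

text \<open>\<open>rev\<close> is its own inverse. The range condition keeps the subtraction from
  truncating, so that reflecting \<open>S\<close> twice gives back \<open>S\<close>.\<close>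

lemma num_words_reverse:
  assumes "S \<subseteq> {2..<k}"
  shows "num_words ((\<lambda>i. k + 1 - i) ` S) k = num_words S k"
proof -
  let ?r = "\<lambda>i. k + 1 - i"
  have rr: "?r ` ?r ` T = T" if "T \<subseteq> {2..<k}" for T
    using that by (force simp: image_image)
  have rev: "rev ` words {..<k} T \<subseteq> words {..<k} (?r ` T)" for T
    using length_word[of _ "{..<k}" T] by (auto simp: words_def list_peaks_rev)
  have "bij_betw rev (words {..<k} S) (words {..<k} (?r ` S))"
  proof (rule bij_betw_byWitness[where f' = rev])
    show "rev ` words {..<k} (?r ` S) \<subseteq> words {..<k} S"
      using rev[of "?r ` S"] rr[OF assms] by simp
  qed (use rev in auto)
  then show ?thesis
    by (simp add: num_words_def bij_betw_same_card)
qed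

text \<open>A peak needs a neighbour on each side. This removes impossible terms from the
  recurrences and settles base cases of the closed forms.\<close>

lemma num_words_out_of_range:
  assumes "\<not> S \<subseteq> {2..<k}"
  shows "num_words S k = 0"
proof -
  have "words {..<k} S = {}"
    using assms list_peaks_subset length_word[of _ "{..<k}" S] by (fastforce simp: words_def)
  then show ?thesis by (simp add: num_words_def)
qed

text \<open>Two neighbouring peaks would each have to exceed the other.\<close>

lemma num_words_adjacent:
  assumes "i \<in> S" "Suc i \<in> S"
  shows "num_words S k = 0"
proof -
  have "words {..<k} S = {}"
    using assms by (fastforce simp: words_def list_peaks_def)
  then show ?thesis by (simp add: num_words_def)
qed

section \<open>Splitting a word at its largest letter\<close>

text \<open>\<open>M\<close> is a peak unless it stands at an end, and it prevents its neighbours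
  from being peaks. Away from \<open>M\<close> nothing changes except the shift by
  \<open>length ys + 1\<close>; hence the case split around the position of
  \<open>M\<close>.\<close>

lemma list_peaks_split_max:
  assumes "\<And>x. x \<in> set ys \<union> set zs \<Longrightarrow> x < M"
  shows "i \<in> list_peaks (ys @ M # zs) \<longleftrightarrow>
    i \<in> list_peaks ys \<or> (i = length ys + 1 \<and> ys \<noteq> [] \<and> zs \<noteq> []) \<or>
    (length ys + 1 < i \<and> i - (length ys + 1) \<in> list_peaks zs)"
proof -
  have ys: "ys ! j < M" if "j < length ys" for j using assms that by simp
  have zs: "zs ! j < M" if "j < length zs" for j using assms that by simp
  consider "i < length ys" | "i = length ys" | "i = length ys + 1" | "i = length ys + 2"
    | "length ys + 3 \<le> i"
    by linarith
  then show ?thesis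
  proof cases
    case 1 then show ?thesis by (auto simp: list_peaks_def nth_append)
  next
    case 2 then show ?thesis using ys[of "i - 1"]
      by (auto simp: list_peaks_def nth_append)
  next
    case 3 then show ?thesis using ys[of "i - 2"] zs[of 0]
      by (cases "ys = []") (auto simp: list_peaks_def nth_append Suc_diff_le)
  next
    case 4 then show ?thesis using zs[of 0]
      by (auto simp: list_peaks_def nth_append dest: order.asym)
  next
    case 5
    then obtain j where "i = length ys + 3 + j" by (metis le_Suc_ex)
    then show ?thesis
      by (simp add: list_peaks_def nth_append numeral_3_eq_3 numeral_2_eq_2)
  qed
qed

lemma sum_Pow_card:
  fixes g :: "nat \<Rightarrow> nat"
  assumes "finite A"
  shows "(\<Sum>B\<in>Pow A. g (card B)) = (\<Sum>i\<le>card A. (card A choose i) * g i)"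
proof -
  have "(\<Sum>B\<in>Pow A. g (card B)) = (\<Sum>i\<le>card A. \<Sum>B | B \<in> Pow A \<and> card B = i. g (card B))"
    using assms by (intro sum.group[symmetric]) (auto intro: card_mono)
  also have "\<dots> = (\<Sum>i\<le>card A. (card A choose i) * g i)"
    using assms by (intro sum.cong) (auto simp: n_subsets)
  finally show ?thesis .
qed

lemma list_peaks_Nil: "list_peaks [] = {}"
  by (simp add: list_peaks_def)

lemma list_peaks_split_max_eq_iff:
  assumes "\<And>x. x \<in> set ys \<union> set zs \<Longrightarrow> x < M"
  shows "list_peaks (ys @ M # zs) = S \<longleftrightarrow>
    list_peaks ys = S \<inter> {..length ys} \<and> (length ys + 1 \<in> S \<longleftrightarrow> ys \<noteq> [] \<and> zs \<noteq> []) \<and>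
    list_peaks zs = {j. 0 < j \<and> j + length ys + 1 \<in> S}" (is "?L \<longleftrightarrow> ?R")
proof -
  have iff: "i \<in> list_peaks (ys @ M # zs) \<longleftrightarrow> i \<in> list_peaks ys \<or>
      (i = length ys + 1 \<and> ys \<noteq> [] \<and> zs \<noteq> []) \<or>
      (length ys + 1 < i \<and> i - (length ys + 1) \<in> list_peaks zs)" for i
    using assms by (rule list_peaks_split_max)
  have ys: "2 \<le> i" "i < length ys" if "i \<in> list_peaks ys" for i
    using that list_peaks_subset by force+
  have zs: "2 \<le> i" "i < length zs" if "i \<in> list_peaks zs" for i
    using that list_peaks_subset by force+
  show ?thesis
  proof
    assume L: ?L
    have S: "i \<in> S \<longleftrightarrow> i \<in> list_peaks ys \<or> (i = length ys + 1 \<and> ys \<noteq> [] \<and> zs \<noteq> []) \<or>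
        (length ys + 1 < i \<and> i - (length ys + 1) \<in> list_peaks zs)" for i
      using iff L by simp
    show ?R
      by (intro conjI set_eqI) (auto simp: S list_peaks_Nil dest: ys zs)
  next
    assume R: ?R
    show ?L
    proof (rule set_eqI)
      fix i
      consider "i \<le> length ys" | "i = length ys + 1" | j where "i = j + length ys + 1" "0 < j"
        by (metis Suc_eq_plus1 add.commute add_Suc_right le_add1 le_less_Suc_eq less_imp_add_positive nat_less_le not_less_eq_eq)
      then show "i \<in> list_peaks (ys @ M # zs) \<longleftrightarrow> i \<in> S"
      proof cases
        case 1 then show ?thesis unfolding iff using R by (auto simp: list_peaks_Nil)
      next
        case 2 then show ?thesis unfolding iff using R by (auto simp: list_peaks_Nil)
      next
        case 3 then show ?thesis unfolding iff using R by (auto simp: list_peaks_Nil)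
      qed
    qed
  qed
qed

text \<open>\<open>i\<close> is the number of letters left of the largest letter \<open>k\<close>;
  they can be chosen in \<open>k choose i\<close> ways, and then both sides are filled
  independently. The condition says that position \<open>i + 1\<close> is a peak exactly when it is
  not an end.\<close>

lemma num_words_Suc_sum:
  "num_words S (Suc k) = (\<Sum>i\<le>k. (k choose i) *
    (if i + 1 \<in> S \<longleftrightarrow> 0 < i \<and> i < k
     then num_words (S \<inter> {..i}) i * num_words {j. 0 < j \<and> j + i + 1 \<in> S} (k - i) else 0))"
proof -
  \<comment> \<open>\<open>V B\<close> collects the possible pairs of left and right words when
    \<open>B\<close> is the set of letters to the left of \<open>k\<close>.\<close>
  define V where "V B = (if card B + 1 \<in> S \<longleftrightarrow> 0 < card B \<and> card B < k
    then words B (S \<inter> {..card B}) \<times> words ({..<k} - B) {j. 0 < j \<and> j + card B + 1 \<in> S} else {})" for B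
  have VD: "set ys = B" "set zs = {..<k} - B" "distinct ys" "distinct zs" "length ys = card B"
    if "(ys, zs) \<in> V B" for B ys zs
    using that by (auto simp: V_def words_def distinct_card split: if_splits)
  have memV: "(ys, zs) \<in> V B \<longleftrightarrow> distinct ys \<and> distinct zs \<and> set ys = B \<and> set zs = {..<k} - B \<and>
      list_peaks (ys @ k # zs) = S" if "B \<subseteq> {..<k}" for B ys zs
  proof (cases "distinct ys \<and> distinct zs \<and> set ys = B \<and> set zs = {..<k} - B")
    case True
    have fin: "finite B" using that finite_subset by blast
    have card: "length ys = card B" "length zs = k - card B"
      using True that fin by (auto simp: distinct_card[symmetric] card_Diff_subset)
    have "ys \<noteq> [] \<longleftrightarrow> 0 < card B" "zs \<noteq> [] \<longleftrightarrow> card B < k"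
      unfolding length_greater_0_conv[symmetric] card by simp_all
    moreover have "list_peaks (ys @ k # zs) = S \<longleftrightarrow>
        list_peaks ys = S \<inter> {..length ys} \<and> (length ys + 1 \<in> S \<longleftrightarrow> ys \<noteq> [] \<and> zs \<noteq> []) \<and>
        list_peaks zs = {j. 0 < j \<and> j + length ys + 1 \<in> S}"
      using True that by (intro list_peaks_split_max_eq_iff) auto
    ultimately show ?thesis
      using True card by (auto simp: V_def words_def)
  next
    case False then show ?thesis using VD by blast
  qed
  let ?glue = "\<lambda>(B, ys, zs). ys @ k # zs"
  \<comment> \<open>\<open>B\<close> is determined by \<open>ys\<close>, but keeping it in the
    triple turns the count into a sum over subsets, whose terms depend only on
    \<open>card B\<close>.\<close>
  have "bij_betw ?glue (Sigma (Pow {..<k}) V) (words {..<Suc k} S)"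
  proof (rule bij_betw_imageI)
    show "inj_on ?glue (Sigma (Pow {..<k}) V)"
    proof (rule inj_onI)
      fix p q assume p: "p \<in> Sigma (Pow {..<k}) V" and q: "q \<in> Sigma (Pow {..<k}) V"
        and eq: "?glue p = ?glue q"
      obtain B ys zs B' ys' zs' where pq: "p = (B, ys, zs)" "q = (B', ys', zs')"
        by (cases p, cases q)
      have *: "B \<subseteq> {..<k}" "(ys, zs) \<in> V B" "B' \<subseteq> {..<k}" "(ys', zs') \<in> V B'"
        "ys @ k # zs = ys' @ k # zs'"
        using p q eq pq by auto
      have "k \<notin> set ys" "k \<notin> set zs" "k \<notin> set ys'" "k \<notin> set zs'"
        using * VD by blast+
      then have "ys = ys' \<and> zs = zs'"
        using *(5) by (metis append_Cons_eq_iff)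
      moreover have "B = B'" using VD(1)[OF *(2)] VD(1)[OF *(4)] calculation by simp
      ultimately show "p = q" by (simp add: pq)
    qed
    show "?glue ` Sigma (Pow {..<k}) V = words {..<Suc k} S"
    proof (intro equalityI subsetI)
      fix xs assume "xs \<in> ?glue ` Sigma (Pow {..<k}) V"
      then obtain B ys zs where "B \<subseteq> {..<k}" "(ys, zs) \<in> V B" "xs = ys @ k # zs"
        by auto
      then show "xs \<in> words {..<Suc k} S"
        by (auto simp: memV words_def)
    next
      fix xs assume xs: "xs \<in> words {..<Suc k} S"
      then have "k \<in> set xs" by (auto simp: words_def)
      then obtain ys zs where s: "xs = ys @ k # zs" by (metis split_list)
      have dist: "distinct ys" "distinct zs" "k \<notin> set ys" "k \<notin> set zs" "set ys \<inter> set zs = {}"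
        and peaks: "list_peaks (ys @ k # zs) = S"
        using xs by (auto simp: s words_def)
      have "insert k (set ys \<union> set zs) = {..<Suc k}"
        using xs by (auto simp: s words_def)
      then have un: "set ys \<union> set zs = {..<k}"
        using dist by (auto simp: lessThan_Suc)
      then have "set ys \<subseteq> {..<k}" "set zs = {..<k} - set ys" using dist(5) by blast+
      then have "(set ys, ys, zs) \<in> Sigma (Pow {..<k}) V"
        using memV[of "set ys" ys zs] dist peaks by auto
      then show "xs \<in> ?glue ` Sigma (Pow {..<k}) V"
        by (rule rev_image_eqI) (simp add: s)
    qed
  qed
  then have "num_words S (Suc k) = card (Sigma (Pow {..<k}) V)"
    by (simp add: num_words_def bij_betw_same_card)
  also have "\<dots> = (\<Sum>B\<in>Pow {..<k}. card (V B))"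
    by (intro card_SigmaI) (auto simp: V_def intro!: finite_cartesian_product finite_words finite_subset[of _ "{..<k}"])
  also have "\<dots> = (\<Sum>B\<in>Pow {..<k}. (\<lambda>i. if i + 1 \<in> S \<longleftrightarrow> 0 < i \<and> i < k
     then num_words (S \<inter> {..i}) i * num_words {j. 0 < j \<and> j + i + 1 \<in> S} (k - i) else 0) (card B))"
  proof (rule sum.cong)
    fix B assume "B \<in> Pow {..<k}"
    then have B: "B \<subseteq> {..<k}" "finite B" by (auto intro: finite_subset)
    then have "card ({..<k} - B) = k - card B"
      by (simp add: card_Diff_subset)
    then show "card (V B) = (\<lambda>i. if i + 1 \<in> S \<longleftrightarrow> 0 < i \<and> i < k
     then num_words (S \<inter> {..i}) i * num_words {j. 0 < j \<and> j + i + 1 \<in> S} (k - i) else 0) (card B)"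
      using B by (auto simp: V_def card_cartesian_product card_words)
  qed simp
  also have "\<dots> = (\<Sum>i\<le>k. (k choose i) *
    (if i + 1 \<in> S \<longleftrightarrow> 0 < i \<and> i < k
     then num_words (S \<inter> {..i}) i * num_words {j. 0 < j \<and> j + i + 1 \<in> S} (k - i) else 0))"
    by (subst sum_Pow_card) simp_all
  finally show ?thesis .
qed

lemma num_words_empty_0: "num_words {} 0 = 1"
proof -
  have "words {..<0} {} = {[]}" by (auto simp: words_def list_peaks_def)
  then show ?thesis by (simp add: num_words_def)
qed

section \<open>The recurrence as a sum over the peak set\<close>

text \<open>This set and \<open>peaks_after\<close> get names so that the simp rules on
  \<open>insert\<close> can evaluate them for explicit peak sets.\<close>

definition peaks_before :: "nat set \<Rightarrow> nat \<Rightarrow> nat set" where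
  "peaks_before S s = S \<inter> {..<s}"

definition peaks_after :: "nat set \<Rightarrow> nat \<Rightarrow> nat set" where
  "peaks_after S s = {j. 0 < j \<and> j + s \<in> S}"

lemma peaks_before_simps [simp]:
  "peaks_before {} s = {}"
  "peaks_before (insert x S) s = (if x < s then insert x (peaks_before S s) else peaks_before S s)"
  by (auto simp: peaks_before_def)

lemma peaks_after_simps [simp]:
  "peaks_after {} s = {}"
  "peaks_after (insert x S) s = (if s < x then insert (x - s) (peaks_after S s) else peaks_after S s)"
  by (auto simp: peaks_after_def)

text \<open>The first two terms place the largest letter at the left and at the right end, and the
  sum places it at a peak. \<open>0 < k\<close> makes the two ends different.\<close>

lemma num_words_Suc:
  assumes S: "S \<subseteq> {2..k}" and "0 < k"
  shows "num_words S (Suc k) = num_words (peaks_after S 1) k + num_words S k +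
    (\<Sum>s\<in>S. (k choose (s - 1)) * num_words (peaks_before S s) (s - 1) *
      num_words (peaks_after S s) (Suc k - s))"
proof -
  define t where "t i = (k choose i) * (if i + 1 \<in> S \<longleftrightarrow> 0 < i \<and> i < k
     then num_words (S \<inter> {..i}) i * num_words {j. 0 < j \<and> j + i + 1 \<in> S} (k - i) else 0)" for i
  have "num_words S (Suc k) = sum t {..k}"
    unfolding t_def by (rule num_words_Suc_sum)
  also have "{..k} = insert 0 (insert k {0<..<k})"
    using \<open>0 < k\<close> by auto
  also have "sum t \<dots> = t 0 + (t k + sum t {0<..<k})"
    using \<open>0 < k\<close> by simp
  also have "t 0 = num_words (peaks_after S 1) k"
  proof -
    have "S \<inter> {..0} = {}" "1 \<notin> S" using S by auto
    then show ?thesis by (simp add: t_def num_words_empty_0 peaks_after_def)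
  qed
  also have "t k = num_words S k"
  proof -
    have "{j. 0 < j \<and> Suc (j + k) \<in> S} = {}" using S by auto
    then have "num_words {j. 0 < j \<and> Suc (j + k) \<in> S} 0 = 1" by (simp only: num_words_empty_0)
    moreover have "S \<inter> {..k} = S" "Suc k \<notin> S" using S by auto
    ultimately show ?thesis by (simp add: t_def num_words_empty_0)
  qed
  \<comment> \<open>At an interior position outside \<open>S\<close> the largest letter would be an
    unwanted peak, so such positions contribute 0.\<close>
  also have "sum t {0<..<k} = (\<Sum>i\<in>(\<lambda>s. s - 1) ` S. t i)"
  proof (rule sum.mono_neutral_right)
    show "\<forall>i\<in>{0<..<k} - (\<lambda>s. s - 1) ` S. t i = 0"
      by (force simp: t_def)
  qed (use S in force)+
  also have "\<dots> = (\<Sum>s\<in>S. t (s - 1))"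
    using S by (intro sum.reindex[unfolded o_def]) (force simp: inj_on_def)
  also have "\<dots> = (\<Sum>s\<in>S. (k choose (s - 1)) * num_words (peaks_before S s) (s - 1) *
      num_words (peaks_after S s) (Suc k - s))"
  proof (rule sum.cong)
    fix s assume "s \<in> S"
    then have s: "2 \<le> s" "s \<le> k" using S by auto
    then have "{..s - 1} = {..<s}" "s - 1 < k" by auto
    then show "t (s - 1) = (k choose (s - 1)) * num_words (peaks_before S s) (s - 1) *
      num_words (peaks_after S s) (Suc k - s)"
      using s \<open>s \<in> S\<close> by (simp add: t_def Suc_diff_le peaks_before_def peaks_after_def)
  qed simp
  finally show ?thesis by simp
qed

lemma num_words_empty: "num_words {} (Suc k) = 2 ^ k"
proof (induction k)
  case 0
  show ?case using num_words_Suc_sum[of "{}" 0] by (simp add: num_words_empty_0)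
next
  case (Suc k)
  then show ?case using num_words_Suc[of "{}" "Suc k"] by simp
qed

section \<open>The recurrence for the peak sets that occur\<close>

lemma num_words_single_rec:
  "num_words {a + 2} (a + b + 3) =
    num_words {a + 1} (a + b + 2) + num_words {a + 2} (a + b + 2) +
    ((a + b + 2) choose (a + 1)) * 2 ^ a * 2 ^ b"
  using num_words_Suc[of "{a + 2}" "a + b + 2"]
  by (simp add: eval_nat_numeral num_words_empty)

text \<open>There is no term with the largest letter in front: behind it, the peak 2 would become a
  peak at position 1.\<close>

lemma num_words_two_rec:
  "num_words {2, a + 4} (a + b + 5) =
    num_words {2, a + 4} (a + b + 4) + (a + b + 4) * num_words {a + 2} (a + b + 3) +
    ((a + b + 4) choose (a + 3)) * num_words {2} (a + 3) * 2 ^ b"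
  using num_words_Suc[of "{2, a + 4}" "a + b + 4"]
  by (simp add: eval_nat_numeral num_words_empty num_words_out_of_range)

lemma num_words_gap_rec:
  "num_words {a + 2, a + 4} (a + b + 5) =
    num_words {a + 1, a + 3} (a + b + 4) + num_words {a + 2, a + 4} (a + b + 4) +
    ((a + b + 4) choose (a + 1)) * 2 ^ a * num_words {2} (b + 3) +
    ((a + b + 4) choose (a + 3)) * num_words {a + 2} (a + 3) * 2 ^ b"
  using num_words_Suc[of "{a + 2, a + 4}" "a + b + 4"]
  by (simp add: eval_nat_numeral num_words_empty)

lemma num_words_two_gap_rec:
  "num_words {2, a + 4, a + 6} (a + b + 7) =
    num_words {2, a + 4, a + 6} (a + b + 6) +
    (a + b + 6) * num_words {a + 2, a + 4} (a + b + 5) +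
    ((a + b + 6) choose (a + 3)) * num_words {2} (a + 3) * num_words {2} (b + 3) +
    ((a + b + 6) choose (a + 5)) * num_words {2, a + 4} (a + 5) * 2 ^ b"
  using num_words_Suc[of "{2, a + 4, a + 6}" "a + b + 6"]
  by (simp add: eval_nat_numeral num_words_empty num_words_out_of_range)

text \<open>The peaks next to the two ends exclude both end terms, so only the four peaks
  contribute.\<close>

lemma num_words_four_rec:
  "num_words {2, a + 4, a + 6, a + b + 8} (a + b + 9) =
    (a + b + 8) * num_words {a + 2, a + 4, a + b + 6} (a + b + 7) +
    ((a + b + 8) choose (a + 3)) * num_words {2} (a + 3) * num_words {2, b + 4} (b + 5) +
    ((a + b + 8) choose (a + 5)) * num_words {2, a + 4} (a + 5) * num_words {b + 2} (b + 3) +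
    (a + b + 8) * num_words {2, a + 4, a + 6} (a + b + 7)"
  using num_words_Suc[of "{2, a + 4, a + 6, a + b + 8}" "a + b + 8"]
  by (simp add: eval_nat_numeral num_words_empty num_words_out_of_range)

section \<open>Closed forms for one, two and three peaks\<close>

text \<open>In the closed forms, \<open>a\<close> and \<open>b\<close> count the positions in the gaps of variable length before,
  between or after the peaks; they remain valid when a gap is empty and both sides vanish.\<close>

lemma num_words_single:
  "real (num_words {a + 1} (a + b + 1)) = (real ((a + b) choose a) - 1) * 2 ^ (a + b) / 2"
proof (induction a arbitrary: b)
  case 0
  show ?case by (simp add: num_words_out_of_range)
next
  case (Suc a)
  \<comment> \<open>The recurrence shortens the gap on either side of the peak, so an induction on
    \<open>b\<close> is nested in the one on \<open>a\<close>. The outer hypothesis is used at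
    \<open>Suc b\<close>.\<close>
  show ?case
  proof (induction b)
    case 0
    show ?case by (simp add: num_words_out_of_range)
  next
    case (Suc b)
    have "real (num_words {a + 2} (a + b + 3)) =
      real (num_words {a + 1} (a + Suc b + 1)) + real (num_words {Suc a + 1} (Suc a + b + 1)) +
      real ((a + b + 2) choose (a + 1)) * 2 ^ a * 2 ^ b"
      using num_words_single_rec[of a b] by (simp add: eval_nat_numeral)
    also have "\<dots> = (real ((a + Suc b) choose a) - 1) * 2 ^ (a + Suc b) / 2 +
        (real ((Suc a + b) choose Suc a) - 1) * 2 ^ (Suc a + b) / 2 +
        real ((a + b + 2) choose (a + 1)) * 2 ^ a * 2 ^ b"
      unfolding Suc \<open>\<And>b. real (num_words {a + 1} (a + b + 1)) = _ b\<close> ..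
    finally show ?case by (simp add: eval_nat_numeral field_simps power_add)
  qed
qed

lemma num_words_2: "real (num_words {2} (b + 2)) = real b * 2 ^ b"
  using num_words_single[of 1 b] by (simp add: eval_nat_numeral)

text \<open>With \<open>N\<close>, \<open>A\<close>, \<open>B\<close> fixed, this turns all binomial coefficients of an induction step into
  polynomial multiples of one number, so that the step becomes a polynomial identity.\<close>

lemma choose_rescale:
  assumes "p \<le> n" "fact n = u * fact N" "fact A = v * fact p" "fact B = w * fact (n - p)"
  shows "real (n choose p) = fact N / (fact A * fact B) * (u * v * w)"
proof -
  have "v \<noteq> 0" "w \<noteq> 0" using assms(3,4) by auto
  then show ?thesis using assms by (simp add: binomial_fact)
qed

lemma choose_add_2: "real ((n + 2) choose n) = (real n + 2) * (real n + 1) / 2"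
  by (induction n) (simp_all add: eval_nat_numeral field_simps)

lemma num_words_two:
  "real (num_words {2, a + 3} (a + b + 3)) = 2 ^ (a + b) *
    (real a * real ((a + b + 1) choose (a + 2)) + (real a + 1) * real ((a + b + 1) choose (a + 1))
      - (real a + real b + 1))"
proof (cases a)
  \<comment> \<open>Peaks 2 and 3 are adjacent, and the formula also gives 0.\<close>
  case 0
  then show ?thesis using num_words_adjacent[of 2 "{2, 3}"] by simp
next
  case (Suc a')
  \<comment> \<open>The recurrence never shortens the gap after the peak 2, so induction on
    \<open>b\<close> alone suffices once \<open>a\<close> is shifted by one.\<close>
  have "real (num_words {2, a + 4} (a + b + 4)) = 2 ^ (a + b + 1) *
    ((real a + 1) * real ((a + b + 2) choose (a + 3)) + (real a + 2) * real ((a + b + 2) choose (a + 2))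
      - (real a + real b + 2))" for a
  proof (induction b)
    case 0
    show ?case by (simp add: num_words_out_of_range)
  next
    case (Suc b)
    \<comment> \<open>\<open>G\<close> takes the smallest upper index, the largest lower index and
      the largest complementary index among the coefficients in \<open>c\<close>, so the cofactors
      are polynomials. The later inductions choose \<open>G\<close> in the same way.\<close>
    define x y G P where "x = real a" and "y = real b"
      and "G = fact (a + b + 2) / (fact (a + 3) * fact (b + 1) :: real)"
      and "P = (2 ^ a * 2 ^ b :: real)"
    have c: "real ((a + b + 2) choose (a + 2)) = G * (1 * (x + 3) * (y + 1))"
      "real ((a + b + 3) choose (a + 3)) = G * ((x + y + 3) * 1 * (y + 1))"
      "real ((a + b + 3) choose (a + 2)) = G * ((x + y + 3) * (x + 3) * 1)"
      "real ((a + b + 2) choose (a + 1)) = G * (1 * ((x + 2) * (x + 3)) * 1)"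
      "real ((a + b + 4) choose (a + 3)) = G * (((x + y + 3) * (x + y + 4)) * 1 * 1)"
      unfolding G_def x_def y_def
      by (rule choose_rescale; simp add: eval_nat_numeral algebra_simps)+
    \<comment> \<open>For \<open>b = 0\<close> the lower index exceeds the upper one and
      \<open>choose_rescale\<close> does not apply; Pascal's rule covers all
      \<open>b\<close>.\<close>
    have c': "real ((a + b + 2) choose (a + 3)) = G * (y * (y + 1))"
      using binomial_Suc_Suc[of "a + b + 2" "a + 2"] c(1,2)
      by (simp add: eval_nat_numeral algebra_simps)
    have "real (num_words {2, a + 4} (a + b + 5)) =
      real (num_words {2, a + 4} (a + b + 4)) + (x + y + 4) * real (num_words {a + 2} (a + b + 3)) +
      real ((a + b + 4) choose (a + 3)) * real (num_words {2} (a + 3)) * 2 ^ b"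
      unfolding num_words_two_rec by (simp add: x_def y_def)
    also have "real (num_words {a + 2} (a + b + 3)) =
        (real ((a + b + 2) choose (a + 1)) - 1) * (2 * P)"
      using num_words_single[of "a + 1" "b + 1"] by (simp add: P_def eval_nat_numeral power_add)
    also have "real (num_words {2} (a + 3)) = (x + 1) * (2 * 2 ^ a)"
      using num_words_2[of "a + 1"] by (simp add: x_def eval_nat_numeral)
    also have "real (num_words {2, a + 4} (a + b + 4)) + (x + y + 4) *
        ((real ((a + b + 2) choose (a + 1)) - 1) * (2 * P)) +
        real ((a + b + 4) choose (a + 3)) * ((x + 1) * (2 * 2 ^ a)) * 2 ^ b =
      4 * P * ((x + 1) * real ((a + b + 3) choose (a + 3)) +
        (x + 2) * real ((a + b + 3) choose (a + 2)) - (x + y + 3))"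
      unfolding Suc c c' x_def[symmetric] y_def[symmetric] P_def
      by (simp add: power_add algebra_simps)
    finally show ?case
      by (simp add: x_def y_def P_def power_add eval_nat_numeral add_ac)
  qed
  from this[of a'] show ?thesis by (simp add: Suc eval_nat_numeral add_ac)
qed

text \<open>For the form: choose the first \<open>a + 2\<close> letters and give them the single
  peak \<open>a + 1\<close>, then append \<open>b + 1\<close> letters without peak. The only
  possible new peak is \<open>a + 3\<close>, so the words with sole peak \<open>a + 1\<close> are
  subtracted. The proof is again a nested induction, as both end terms occur.\<close>

lemma num_words_gap:
  "real (num_words {a + 1, a + 3} (a + b + 3)) = 2 ^ (a + b) *
    (real a * real ((a + b + 3) choose (a + 2)) - 2 * real ((a + b + 2) choose a) + 2)"
proof (induction a arbitrary: b)
  case 0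
  show ?case by (simp add: num_words_out_of_range)
next
  case IHa: (Suc a)
  show ?case
  proof (induction b)
    case 0
    \<comment> \<open>The second peak would be the last position; the formula vanishes as a
      polynomial in \<open>a\<close>.\<close>
    show ?case using choose_add_2[of "a + 1"]
      by (simp add: num_words_out_of_range eval_nat_numeral field_simps)
  next
    case (Suc b)
    define x y G P where "x = real a" and "y = real b"
      and "G = fact (a + b + 3) / (fact (a + 3) * fact (b + 3) :: real)"
      and "P = (2 ^ a * 2 ^ b :: real)"
    have c: "real ((a + b + 5) choose (a + 3)) = G * (((x + y + 4) * (x + y + 5)) * 1 * (y + 3))"
      "real ((a + b + 4) choose (a + 1)) = G * ((x + y + 4) * ((x + 2) * (x + 3)) * 1)"
      "real ((a + b + 4) choose (a + 2)) = G * ((x + y + 4) * (x + 3) * (y + 3))"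
      "real ((a + b + 3) choose a) = G * (1 * ((x + 1) * (x + 2) * (x + 3)) * 1)"
      "real ((a + b + 4) choose (a + 3)) = G * ((x + y + 4) * 1 * ((y + 2) * (y + 3)))"
      "real ((a + b + 3) choose (a + 1)) = G * (1 * ((x + 2) * (x + 3)) * (y + 3))"
      unfolding G_def x_def y_def
      by (rule choose_rescale; simp add: eval_nat_numeral algebra_simps)+
    have "real (num_words {a + 2, a + 4} (a + b + 5)) =
      real (num_words {a + 1, a + 3} (a + b + 4)) + real (num_words {a + 2, a + 4} (a + b + 4)) +
      real ((a + b + 4) choose (a + 1)) * 2 ^ a * real (num_words {2} (b + 3)) +
      real ((a + b + 4) choose (a + 3)) * real (num_words {a + 2} (a + 3)) * 2 ^ b"
      unfolding num_words_gap_rec by simp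
    also have "real (num_words {a + 1, a + 3} (a + b + 4)) = 2 * P *
        (x * real ((a + b + 4) choose (a + 2)) - 2 * real ((a + b + 3) choose a) + 2)"
      using IHa[of "b + 1"] by (simp add: x_def P_def eval_nat_numeral power_add)
    also have "real (num_words {a + 2, a + 4} (a + b + 4)) = 2 * P *
        ((x + 1) * real ((a + b + 4) choose (a + 3)) - 2 * real ((a + b + 3) choose (a + 1)) + 2)"
      using Suc by (simp add: x_def P_def eval_nat_numeral power_add add_ac)
    also have "real (num_words {2} (b + 3)) = (y + 1) * (2 * 2 ^ b)"
      using num_words_2[of "b + 1"] by (simp add: y_def eval_nat_numeral)
    also have "real (num_words {a + 2} (a + 3)) = (x + 1) * (2 * 2 ^ a)"
      using num_words_single[of "a + 1" 1] by (simp add: x_def eval_nat_numeral)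
    also have "2 * P * (x * real ((a + b + 4) choose (a + 2)) - 2 * real ((a + b + 3) choose a) + 2) +
        2 * P * ((x + 1) * real ((a + b + 4) choose (a + 3)) - 2 * real ((a + b + 3) choose (a + 1)) + 2) +
        real ((a + b + 4) choose (a + 1)) * 2 ^ a * ((y + 1) * (2 * 2 ^ b)) +
        real ((a + b + 4) choose (a + 3)) * ((x + 1) * (2 * 2 ^ a)) * 2 ^ b =
      4 * P * ((x + 1) * real ((a + b + 5) choose (a + 3)) - 2 * real ((a + b + 4) choose (a + 1)) + 2)"
      unfolding c P_def by (simp add: algebra_simps)
    finally show ?case
      by (simp add: x_def P_def power_add eval_nat_numeral add_ac)
  qed
qed

text \<open>The form arises as in \<open>num_words_gap\<close>, now with peaks 2 and
  \<open>a + 3\<close> among the first \<open>a + 4\<close> letters: what is subtracted is the count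
  from \<open>num_words_two\<close> with \<open>b + 2\<close> for \<open>b\<close>. The proof is an
  induction on \<open>b\<close>.\<close>

lemma num_words_two_gap:
  "real (num_words {2, a + 3, a + 5} (a + b + 5)) =
    2 ^ (a + b + 1) * (real a * (real a + 3) * real ((a + b + 5) choose (a + 4))
      - 2 * (real a * real ((a + b + 3) choose (a + 2)) + (real a + 1) * real ((a + b + 3) choose (a + 1))
        - (real a + real b + 3)))"
proof (cases a)
  case 0
  then show ?thesis using num_words_adjacent[of 2 "{2, 3, 5}"] by simp
next
  case (Suc a')
  have "real (num_words {2, a + 4, a + 6} (a + b + 6)) =
    2 ^ (a + b + 2) * ((real a + 1) * (real a + 4) * real ((a + b + 6) choose (a + 5))
      - 2 * ((real a + 1) * real ((a + b + 4) choose (a + 3)) + (real a + 2) * real ((a + b + 4) choose (a + 2))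
        - (real a + real b + 4)))" for a
  proof (induction b)
    case 0
    show ?case using choose_add_2[of "a + 2"]
      by (simp add: num_words_out_of_range eval_nat_numeral field_simps)
  next
    case (Suc b)
    define x y G P where "x = real a" and "y = real b"
      and "G = fact (a + b + 4) / (fact (a + 5) * fact (b + 3) :: real)"
      and "P = (2 ^ a * 2 ^ b :: real)"
    have c: "real ((a + b + 7) choose (a + 5)) = G * (((x + y + 5) * (x + y + 6) * (x + y + 7)) * 1 * (y + 3))"
      "real ((a + b + 5) choose (a + 3)) = G * ((x + y + 5) * ((x + 4) * (x + 5)) * (y + 3))"
      "real ((a + b + 5) choose (a + 2)) = G * ((x + y + 5) * ((x + 3) * (x + 4) * (x + 5)) * 1)"
      "real ((a + b + 6) choose (a + 5)) = G * (((x + y + 5) * (x + y + 6)) * 1 * ((y + 2) * (y + 3)))"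
      "real ((a + b + 4) choose (a + 3)) = G * (1 * ((x + 4) * (x + 5)) * ((y + 2) * (y + 3)))"
      "real ((a + b + 4) choose (a + 2)) = G * (1 * ((x + 3) * (x + 4) * (x + 5)) * (y + 3))"
      "real ((a + b + 4) choose (a + 1)) = G * (1 * ((x + 2) * (x + 3) * (x + 4) * (x + 5)) * 1)"
      "real ((a + b + 6) choose (a + 3)) = G * (((x + y + 5) * (x + y + 6)) * ((x + 4) * (x + 5)) * 1)"
      unfolding G_def x_def y_def
      by (rule choose_rescale; simp add: eval_nat_numeral algebra_simps)+
    have "real (num_words {2, a + 4, a + 6} (a + b + 7)) =
      real (num_words {2, a + 4, a + 6} (a + b + 6)) +
      (x + y + 6) * real (num_words {a + 2, a + 4} (a + b + 5)) +
      real ((a + b + 6) choose (a + 3)) * real (num_words {2} (a + 3)) * real (num_words {2} (b + 3)) +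
      real ((a + b + 6) choose (a + 5)) * real (num_words {2, a + 4} (a + 5)) * 2 ^ b"
      unfolding num_words_two_gap_rec by (simp add: x_def y_def)
    also have "real (num_words {a + 2, a + 4} (a + b + 5)) = 4 * P *
        ((x + 1) * real ((a + b + 5) choose (a + 3)) - 2 * real ((a + b + 4) choose (a + 1)) + 2)"
      using num_words_gap[of "a + 1" "b + 1"] by (simp add: x_def P_def eval_nat_numeral power_add add_ac)
    also have "real (num_words {2} (a + 3)) = (x + 1) * (2 * 2 ^ a)"
      using num_words_2[of "a + 1"] by (simp add: x_def eval_nat_numeral)
    also have "real (num_words {2} (b + 3)) = (y + 1) * (2 * 2 ^ b)"
      using num_words_2[of "b + 1"] by (simp add: y_def eval_nat_numeral)
    also have "real (num_words {2, a + 4} (a + 5)) = (x + 1) * (x + 4) * (4 * 2 ^ a)"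
      using num_words_two[of "a + 1" 1] by (simp add: x_def eval_nat_numeral algebra_simps)
    also have "real (num_words {2, a + 4, a + 6} (a + b + 6)) + (x + y + 6) * (4 * P *
        ((x + 1) * real ((a + b + 5) choose (a + 3)) - 2 * real ((a + b + 4) choose (a + 1)) + 2)) +
        real ((a + b + 6) choose (a + 3)) * ((x + 1) * (2 * 2 ^ a)) * ((y + 1) * (2 * 2 ^ b)) +
        real ((a + b + 6) choose (a + 5)) * ((x + 1) * (x + 4) * (4 * 2 ^ a)) * 2 ^ b =
      8 * P * ((x + 1) * (x + 4) * real ((a + b + 7) choose (a + 5))
        - 2 * ((x + 1) * real ((a + b + 5) choose (a + 3)) + (x + 2) * real ((a + b + 5) choose (a + 2))
          - (x + y + 5)))"
      unfolding Suc c x_def[symmetric] y_def[symmetric] P_def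
      by (simp add: power_add algebra_simps)
    finally show ?case
      by (simp add: x_def y_def P_def power_add eval_nat_numeral add_ac)
  qed
  from this[of a'] show ?thesis by (simp add: Suc eval_nat_numeral add_ac)
qed

section \<open>Four peaks: reversal and assembly\<close>

text \<open>By reversal one closed form serves both three-peak terms of
  \<open>num_words_four_rec\<close>. \<open>0 < a\<close> keeps the peak \<open>b + 5\<close> away
  from the last position.\<close>

lemma num_words_gap_two:
  assumes "0 < a"
  shows "num_words {a + 1, a + 3, a + b + 4} (a + b + 5) = num_words {2, b + 3, b + 5} (a + b + 5)"
proof -
  have "(\<lambda>i. a + b + 5 + 1 - i) ` {2, b + 3, b + 5} = {a + 1, a + 3, a + b + 4}"
    by auto
  then show ?thesis
    using num_words_reverse[of "{2, b + 3, b + 5}" "a + b + 5"] assms by simp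
qed

theorem theorem4p4:
  fixes m n :: nat and S :: "nat set" and p :: real
  assumes "m \<ge> 4" and "n \<ge> m + 5"
    and "S = {2, m, m + 2, n - 1}"
    and "real (card (peak_perms S n)) = p * 2 ^ (n - 5)"
  shows "2 * p =
      (real m - 3) * (real n - real m - 4) *
        (real m * real ((n - 1) choose (m + 1))
          + (real n - real m - 1) * real ((n - 1) choose (m - 1)))
      + (real n - 1) *
        (real m * (real m - 3) * real ((n - 2) choose (m + 1))
          + (real n - real m - 1) * (real n - real m - 4) * real ((n - 2) choose (m - 2))
          - 2 * (real n - 6) * real ((n - 4) choose (m - 1))
          - 2 * (real n - 6) * real ((n - 4) choose (m - 2))
          + 4 * real ((n - 4) choose 1))"
proof -
  \<comment> \<open>The free parameters are \<open>a = m - 4\<close> and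
    \<open>b = n - m - 5\<close>, which the two hypotheses make natural numbers.\<close>
  obtain a where m: "m = a + 4" using assms(1) by (metis add.commute le_Suc_ex)
  obtain b where n: "n = a + b + 9"
    using assms(2) le_Suc_ex[of "m + 5" n] by (auto simp: m)
  define x y P where "x = real a" and "y = real b" and "P = (2 ^ a * 2 ^ b :: real)"
  \<comment> \<open>Stated for general \<open>c\<close> and \<open>d\<close> because it is used both
    for \<open>a\<close>, \<open>b\<close> and, after reversal, for \<open>b\<close>,
    \<open>a\<close>.\<close>
  have two_gap: "real (num_words {2, c + 4, c + 6} (c + d + 7)) =
      8 * (2 ^ c * 2 ^ d) * ((real c + 1) * (real c + 4) * real ((c + d + 7) choose (c + 5))
        - 2 * ((real c + 1) * real ((c + d + 5) choose (c + 3))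
          + (real c + 2) * real ((c + d + 5) choose (c + 2)) - (real c + real d + 5)))" for c d
    using num_words_two_gap[of "c + 1" "d + 1"]
    by (simp add: eval_nat_numeral power_add add_ac)
  have "S = {2, a + 4, a + 6, a + b + 8}"
    using assms(3) by (simp add: m n add_ac)
  then have "p * (16 * P) = real (num_words {2, a + 4, a + 6, a + b + 8} (a + b + 9))"
    using assms(4) by (simp add: card_peak_perms n P_def power_add mult_ac)
  also have "\<dots> =
      (x + y + 8) * real (num_words {a + 2, a + 4, a + b + 6} (a + b + 7)) +
      real ((a + b + 8) choose (a + 3)) * real (num_words {2} (a + 3)) * real (num_words {2, b + 4} (b + 5)) +
      real ((a + b + 8) choose (a + 5)) * real (num_words {2, a + 4} (a + 5)) * real (num_words {b + 2} (b + 3)) +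
      (x + y + 8) * real (num_words {2, a + 4, a + 6} (a + b + 7))"
    unfolding num_words_four_rec by (simp add: x_def y_def)
  also have "real (num_words {a + 2, a + 4, a + b + 6} (a + b + 7)) =
      8 * P * ((y + 1) * (y + 4) * real ((a + b + 7) choose (a + 2))
        - 2 * ((y + 1) * real ((a + b + 5) choose (a + 2)) + (y + 2) * real ((a + b + 5) choose (a + 3))
          - (x + y + 5)))"
  proof -
    \<comment> \<open>Reversal exchanges \<open>a\<close> and \<open>b\<close>; reflecting the
      binomial coefficients restores lower indices in terms of \<open>a\<close>.\<close>
    have sym: "k choose i = k choose j" if "k = i + j" for i j k :: nat
      using that binomial_symmetric[of i k] by simp
    have choose: "(a + b + 7) choose (a + 2) = (a + b + 7) choose (b + 5)"
      "(a + b + 5) choose (a + 2) = (a + b + 5) choose (b + 3)"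
      "(a + b + 5) choose (a + 3) = (a + b + 5) choose (b + 2)"
      by (rule sym, linarith)+
    have "num_words {a + 2, a + 4, a + b + 6} (a + b + 7) = num_words {2, b + 4, b + 6} (b + a + 7)"
      using num_words_gap_two[of "a + 1" "b + 1"] by (simp add: eval_nat_numeral add_ac)
    then show ?thesis
      unfolding choose x_def y_def P_def
      using two_gap[of b a]
      by (simp only: add.commute[of b a] add.commute[of "real b" "real a"]
          mult.commute[of "2 ^ b" "2 ^ a :: real"])
  qed
  also have "real (num_words {2, a + 4, a + 6} (a + b + 7)) =
      8 * P * ((x + 1) * (x + 4) * real ((a + b + 7) choose (a + 5))
        - 2 * ((x + 1) * real ((a + b + 5) choose (a + 3)) + (x + 2) * real ((a + b + 5) choose (a + 2))
          - (x + y + 5)))"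
    unfolding x_def y_def P_def by (rule two_gap)
  also have "real (num_words {2} (a + 3)) = (x + 1) * (2 * 2 ^ a)"
    using num_words_2[of "a + 1"] by (simp add: x_def eval_nat_numeral)
  also have "real (num_words {2, b + 4} (b + 5)) = (y + 1) * (y + 4) * (4 * 2 ^ b)"
    using num_words_two[of "b + 1" 1] by (simp add: y_def eval_nat_numeral algebra_simps)
  also have "real (num_words {2, a + 4} (a + 5)) = (x + 1) * (x + 4) * (4 * 2 ^ a)"
    using num_words_two[of "a + 1" 1] by (simp add: x_def eval_nat_numeral algebra_simps)
  also have "real (num_words {b + 2} (b + 3)) = (y + 1) * (2 * 2 ^ b)"
    using num_words_single[of "b + 1" 1] by (simp add: y_def eval_nat_numeral)
  \<comment> \<open>Every term on the right contains \<open>8 * P\<close>, while the left side is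
    \<open>16 * P * p\<close>, which is where the factor 2 comes from. The two subtracted brackets
    merge because \<open>(x + 2) + (y + 1) = x + y + 3\<close>, which is
    \<open>n - 6\<close>.\<close>
  finally have "8 * P * (2 * p) = 8 * P * ((x + 1) * (y + 1) *
        ((x + 4) * real ((a + b + 8) choose (a + 5)) + (y + 4) * real ((a + b + 8) choose (a + 3)))
      + (x + y + 8) *
        ((x + 4) * (x + 1) * real ((a + b + 7) choose (a + 5))
          + (y + 4) * (y + 1) * real ((a + b + 7) choose (a + 2))
          - 2 * (x + y + 3) * real ((a + b + 5) choose (a + 3))
          - 2 * (x + y + 3) * real ((a + b + 5) choose (a + 2))
          + 4 * (x + y + 5)))"
    unfolding P_def by (simp add: algebra_simps)
  moreover have "8 * P \<noteq> 0" by (simp add: P_def)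
  ultimately have "2 * p = (x + 1) * (y + 1) *
        ((x + 4) * real ((a + b + 8) choose (a + 5)) + (y + 4) * real ((a + b + 8) choose (a + 3)))
      + (x + y + 8) *
        ((x + 4) * (x + 1) * real ((a + b + 7) choose (a + 5))
          + (y + 4) * (y + 1) * real ((a + b + 7) choose (a + 2))
          - 2 * (x + y + 3) * real ((a + b + 5) choose (a + 3))
          - 2 * (x + y + 3) * real ((a + b + 5) choose (a + 2))
          + 4 * (x + y + 5))"
    by (simp only: mult_cancel_left simp_thms)
  moreover have "m - 1 = a + 3" "m - 2 = a + 2" "m + 1 = a + 5"
    "n - 1 = a + b + 8" "n - 2 = a + b + 7" "n - 4 = a + b + 5"
    by (simp_all add: m n)
  moreover have "real m = x + 4" "real n = x + y + 9"
    by (simp_all add: m n x_def y_def)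
  moreover have "real ((a + b + 5) choose 1) = x + y + 5"
    by (simp add: x_def y_def)
  ultimately show ?thesis
    by (simp only:) (simp add: algebra_simps)
qed

end
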